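(* Every Steiner triple system except the Fano plane contains a wicket.
   Context: A Steiner triple system of order $n$, STS$(n)$, is an $n$-element set $V$ of points together with a set $\mathcal B$ of $3$-element subsets of $V$, called blocks, such that each pair of elements of $V$ appears in exactly one block of $\mathcal B$. It is well known that an STS$(n)$ exists if and only if $n\equiv 1$ or $n\equiv 3 \pmod 6$. The Fano plane is the (unique up to isomorphism) STS$(7)$. The wicket is the configuration of five blocks on nine distinct points $p_{ij}$, $1\le i,j\le 3$, formed by the three rows $\{p_{i1},p_{i2},p_{i3}\}$, $i=1,2,3$, and two columns $\{p_{1j},p_{2j},p_{3j}\}$, $j=1,2$, of the $3\times 3$ point matrix. A Steiner triple system contains a wicket if it has nine distinct points $p_{ij}$ such that all these five triples are blocks.
   Formalization: The Steiner triple system is assumed to have more than three points, because the trivial systems STS(1) and STS(3) have fewer than nine points and so contain no wicket, although they are not the Fano plane. *)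

theory Defs
  imports Main
begin

definition steiner_triple_system :: "'a set \<Rightarrow> 'a set set \<Rightarrow> bool" where
  "steiner_triple_system V B \<longleftrightarrow>
     finite V \<and>
     (\<forall>b\<in>B. b \<subseteq> V \<and> card b = 3) \<and>
     (\<forall>x\<in>V. \<forall>y\<in>V. x \<noteq> y \<longrightarrow> (\<exists>!b. b \<in> B \<and> {x, y} \<subseteq> b))"

definition triple_system_iso ::
  "'a set \<Rightarrow> 'a set set \<Rightarrow> 'b set \<Rightarrow> 'b set set \<Rightarrow> bool" where
  "triple_system_iso V B W C \<longleftrightarrow>
     (\<exists>f. bij_betw f V W \<and> (\<lambda>b. f ` b) ` B = C)"

text \<open>The model of the Fano plane developed from the perfect difference set
  \<open>{0, 1, 3}\<close> modulo \<open>7\<close>.\<close>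

definition fano_points :: "nat set" where
  "fano_points = {0, 1, 2, 3, 4, 5, 6}"

definition fano_blocks :: "nat set set" where
  "fano_blocks = {{0,1,3}, {1,2,4}, {2,3,5}, {3,4,6}, {4,5,0}, {5,6,1}, {6,0,2}}"

definition is_fano_plane :: "'a set \<Rightarrow> 'a set set \<Rightarrow> bool" where
  "is_fano_plane V B \<longleftrightarrow> triple_system_iso V B fano_points fano_blocks"

text \<open>The point \<open>p i j\<close> stands in row \<open>i\<close> and column \<open>j\<close> of the point matrix;
  nothing is required of the third column.\<close>

definition contains_wicket :: "'a set \<Rightarrow> 'a set set \<Rightarrow> bool" where
  "contains_wicket V B \<longleftrightarrow>
     (\<exists>p :: nat \<Rightarrow> nat \<Rightarrow> 'a.
        (\<forall>i\<in>{1..3}. \<forall>j\<in>{1..3}. p i j \<in> V) \<and>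
        inj_on (\<lambda>(i, j). p i j) ({1..3} \<times> {1..3}) \<and>
        (\<forall>i\<in>{1..3}. {p i 1, p i 2, p i 3} \<in> B) \<and>
        (\<forall>j\<in>{1..2}. {p 1 j, p 2 j, p 3 j} \<in> B))"

end

theory Submission
  imports Defs
begin

text \<open>Two disjoint blocks \<open>{a1, a2, a3}\<close> and \<open>{b1, b2, b3}\<close> already force a wicket. They
  serve as its two columns, so what is missing is a matching of the \<open>a\<close>s with the \<open>b\<close>s for which
  the three blocks through matched pairs are disjoint, that is, have distinct third points. The
  third points of the nine blocks joining \<open>ai\<close> to \<open>bj\<close> form a \<open>3 \<times> 3\<close> array without repetition in
  any row or column, and a matching is a transversal of this array; lemma \<open>rainbow_transversal\<close>
  finds, by counting, a transversal with three distinct entries.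

  There remain the systems in which any two blocks meet. Fix a block \<open>{a, b, c}\<close> and a point \<open>x\<close>
  off it. Every block through \<open>x\<close> meets \<open>{a, b, c}\<close>, so there are only the three blocks
  \<open>{x, a, p}\<close>, \<open>{x, b, q}\<close>, \<open>{x, c, r}\<close>, and their seven points are all the points. The remaining
  blocks are then forced, and the system is the Fano plane.\<close>

section \<open>Blocks and third points\<close>

lemma steiner_block_unique:
  assumes "steiner_triple_system V B"
    and "b \<in> B" "c \<in> B" "x \<noteq> y" "x \<in> b" "y \<in> b" "x \<in> c" "y \<in> c"
  shows "b = c"
proof -
  have "b \<subseteq> V"
    using assms(1,2) unfolding steiner_triple_system_def by simp
  then have "x \<in> V" "y \<in> V"
    using assms(5,6) by auto
  then have "\<exists>!b. b \<in> B \<and> {x, y} \<subseteq> b"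
    using assms(1,4) unfolding steiner_triple_system_def by simp
  then show ?thesis
    using assms(2,3,5-8) by auto
qed

lemma steiner_block_mem:
  assumes "steiner_triple_system V B"
    and "b \<in> B" "c \<in> B" "x \<noteq> y" "x \<in> b" "y \<in> b" "x \<in> c" "y \<in> c" "z \<in> b"
  shows "z \<in> c"
  using steiner_block_unique[OF assms(1-8)] assms(9) by simp

lemma steiner_block_through:
  assumes "steiner_triple_system V B" and "x \<in> V" "y \<in> V" "x \<noteq> y"
  obtains b where "b \<in> B" "x \<in> b" "y \<in> b"
proof -
  have "\<exists>!b. b \<in> B \<and> {x, y} \<subseteq> b"
    using assms unfolding steiner_triple_system_def by simp
  then show thesis
    using that by auto
qed

lemma steiner_third_point:
  assumes "steiner_triple_system V B" and "x \<in> V" "y \<in> V" "x \<noteq> y"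
  obtains z where "{x, y, z} \<in> B" "z \<noteq> x" "z \<noteq> y"
proof -
  obtain b where b: "b \<in> B" "x \<in> b" "y \<in> b"
    using steiner_block_through[OF assms] .
  then have "card b = 3"
    using assms(1) unfolding steiner_triple_system_def by blast
  then have "card (b - {x, y}) = 1"
    using b \<open>x \<noteq> y\<close> by (simp add: card_Diff_subset)
  then obtain z where "b - {x, y} = {z}"
    by (rule card_1_singletonE)
  then have "b = {x, y, z}" "z \<noteq> x" "z \<noteq> y"
    using b by auto
  then show thesis
    using that b by blast
qed

lemma steiner_block_points:
  assumes "steiner_triple_system V B" and "b \<in> B"
  obtains x y z where "b = {x, y, z}" "x \<noteq> y" "x \<noteq> z" "y \<noteq> z"
proof -
  have "card b = 3"
    using assms unfolding steiner_triple_system_def by simp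
  then show thesis
    using that unfolding card_3_iff by blast
qed

section \<open>Disjoint blocks\<close>

text \<open>Two cells in different rows and columns lie on exactly one of the six transversals. So all
  cells carrying a given symbol can spoil only one transversal: there are at most three of them,
  and if there are three, they form a transversal themselves. To spoil all six transversals takes
  six symbols occurring at least twice each, hence twelve cells, but there are only nine.\<close>

lemma rainbow_transversal:
  assumes "distinct [t11, t12, t13]" "distinct [t21, t22, t23]" "distinct [t31, t32, t33]"
    and "distinct [t11, t21, t31]" "distinct [t12, t22, t32]" "distinct [t13, t23, t33]"
  shows "distinct [t11, t22, t33] \<or> distinct [t12, t23, t31] \<or> distinct [t13, t21, t32] \<or>
    distinct [t11, t23, t32] \<or> distinct [t12, t21, t33] \<or> distinct [t13, t22, t31]"
  using assms by (simp, smt (verit))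

lemma contains_wicketI:
  assumes "distinct [p11, p12, p13, p21, p22, p23, p31, p32, p33]"
    and "{p11, p12, p13, p21, p22, p23, p31, p32, p33} \<subseteq> V"
    and "{p11, p12, p13} \<in> B" "{p21, p22, p23} \<in> B" "{p31, p32, p33} \<in> B"
    and "{p11, p21, p31} \<in> B" "{p12, p22, p32} \<in> B"
  shows "contains_wicket V B"
proof -
  define p :: "nat \<Rightarrow> nat \<Rightarrow> 'a" where
    "p i j = [[p11, p12, p13], [p21, p22, p23], [p31, p32, p33]] ! (i - 1) ! (j - 1)" for i j
  have three: "{1..3} = {1, 2, 3 :: nat}" and two: "{1..2} = {1, 2 :: nat}"
    by auto
  have p: "p (Suc 0) (Suc 0) = p11" "p (Suc 0) 2 = p12" "p (Suc 0) 3 = p13"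
    "p 2 (Suc 0) = p21" "p 2 2 = p22" "p 2 3 = p23" "p 3 (Suc 0) = p31" "p 3 2 = p32" "p 3 3 = p33"
    by (simp_all add: p_def)
  have "\<forall>i\<in>{1..3}. \<forall>j\<in>{1..3}. p i j \<in> V"
    using assms(2) unfolding three by (simp add: p)
  moreover have "inj_on (\<lambda>(i, j). p i j) ({1..3} \<times> {1..3})"
    using assms(1) unfolding three inj_on_def
    by (simp add: p) (metis)
  moreover have "\<forall>i\<in>{1..3}. {p i 1, p i 2, p i 3} \<in> B"
    using assms(3-5) unfolding three by (simp add: p)
  moreover have "\<forall>j\<in>{1..2}. {p 1 j, p 2 j, p 3 j} \<in> B"
    using assms(6,7) unfolding two by (simp add: p)
  ultimately show ?thesis
    unfolding contains_wicket_def by blast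
qed

text \<open>The third points of the joining blocks lie off both given blocks, because a joining block
  that meets one of them in two points would coincide with it and make the two intersect. Hence
  only coincidences between third points can prevent a matching from giving a wicket.\<close>

lemma disjoint_blocks_imp_wicket:
  assumes sts: "steiner_triple_system V B"
    and "b \<in> B" "c \<in> B" "b \<inter> c = {}"
  shows "contains_wicket V B"
proof -
  obtain a1 a2 a3 where a: "b = {a1, a2, a3}" "a1 \<noteq> a2" "a1 \<noteq> a3" "a2 \<noteq> a3"
    using steiner_block_points[OF sts \<open>b \<in> B\<close>] .
  obtain b1 b2 b3 where b: "c = {b1, b2, b3}" "b1 \<noteq> b2" "b1 \<noteq> b3" "b2 \<noteq> b3"
    using steiner_block_points[OF sts \<open>c \<in> B\<close>] .
  note mem = steiner_block_mem[OF sts]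
  have in_V: "e \<subseteq> V" if "e \<in> B" for e
    using sts that unfolding steiner_triple_system_def by blast
  have ab: "x \<in> V" "y \<in> V" "x \<noteq> y" if "x \<in> b" "y \<in> c" for x y
    using that in_V assms by auto
  have "\<forall>x\<in>b. \<forall>y\<in>c. \<exists>z. {x, y, z} \<in> B \<and> z \<noteq> x \<and> z \<noteq> y"
    using ab steiner_third_point[OF sts] by metis
  then obtain t where t: "{x, y, t x y} \<in> B" "t x y \<noteq> x" "t x y \<noteq> y" if "x \<in> b" "y \<in> c" for x y
    by metis
  have new: "t x y \<notin> b \<union> c" if "x \<in> b" "y \<in> c" for x y
  proof
    assume "t x y \<in> b \<union> c"
    then have "y \<in> b \<or> x \<in> c"
      using mem[OF t(1)[OF that] \<open>b \<in> B\<close>, of x "t x y" y]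
        mem[OF t(1)[OF that] \<open>c \<in> B\<close>, of y "t x y" x] t(2,3)[OF that, symmetric] that
      by blast
    then show False
      using that \<open>b \<inter> c = {}\<close> by blast
  qed
  have row: "t x y \<noteq> t x y'" if "x \<in> b" "y \<in> c" "y' \<in> c" "y \<noteq> y'" for x y y'
  proof
    assume "t x y = t x y'"
    then have "y' \<in> {x, y, t x y}"
      using mem[OF t(1)[of x y'] t(1)[of x y], of x "t x y" y'] t(2)[of x y, symmetric] that by simp
    then show False
      using that new[of x y] ab by blast
  qed
  have col: "t x y \<noteq> t x' y" if "x \<in> b" "x' \<in> b" "y \<in> c" "x \<noteq> x'" for x x' y
  proof
    assume "t x y = t x' y"
    then have "x' \<in> {x, y, t x y}"
      using mem[OF t(1)[of x' y] t(1)[of x y], of y "t x y" x'] t(3)[of x y, symmetric] that by simp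
    then show False
      using that new[of x y] ab by blast
  qed
  have matching: "contains_wicket V B"
    if "distinct [t a1 y1, t a2 y2, t a3 y3]" and y: "{y1, y2, y3} = c" "distinct [y1, y2, y3]"
    for y1 y2 y3
  proof (rule contains_wicketI)
    have c: "y1 \<in> c" "y2 \<in> c" "y3 \<in> c" and b: "a1 \<in> b" "a2 \<in> b" "a3 \<in> b"
      using y a by auto
    show rows: "{a1, y1, t a1 y1} \<in> B" "{a2, y2, t a2 y2} \<in> B" "{a3, y3, t a3 y3} \<in> B"
      using t(1) b c by auto
    show "{a1, a2, a3} \<in> B" "{y1, y2, y3} \<in> B"
      using a y assms by auto
    show "{a1, y1, t a1 y1, a2, y2, t a2 y2, a3, y3, t a3 y3} \<subseteq> V"
      using rows[THEN in_V] by blast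
    show "distinct [a1, y1, t a1 y1, a2, y2, t a2 y2, a3, y3, t a3 y3]"
      using that(1) y(2) a(2-4) \<open>b \<inter> c = {}\<close> new[OF b(1) c(1)] new[OF b(2) c(2)] new[OF b(3) c(3)]
      unfolding a(1) y(1)[symmetric] by auto
  qed
  have abc: "a1 \<in> b" "a2 \<in> b" "a3 \<in> b" "b1 \<in> c" "b2 \<in> c" "b3 \<in> c"
    using a b by auto
  have "distinct [t a1 b1, t a2 b2, t a3 b3] \<or> distinct [t a1 b2, t a2 b3, t a3 b1] \<or>
    distinct [t a1 b3, t a2 b1, t a3 b2] \<or> distinct [t a1 b1, t a2 b3, t a3 b2] \<or>
    distinct [t a1 b2, t a2 b1, t a3 b3] \<or> distinct [t a1 b3, t a2 b2, t a3 b1]"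
    by (rule rainbow_transversal) (use a(2-4) b(2-4) abc row col in simp_all)
  then show ?thesis
    using b by (elim disjE) (erule matching; auto)+
qed

section \<open>Systems without disjoint blocks\<close>

lemma fano_plane_coordinates:
  assumes dist: "distinct [a, b, c, x, p, q, r]"
    and B: "B = {{a, b, c}, {x, a, p}, {x, b, q}, {x, c, r}, {a, q, r}, {b, p, r}, {c, p, q}}"
  shows "is_fano_plane {a, b, c, x, p, q, r} B"
proof -
  \<comment> \<open>Send \<open>a\<close>, \<open>b\<close>, \<open>c\<close> to the points \<open>0\<close>, \<open>1\<close>, \<open>3\<close> of a line and \<open>x\<close> to a point \<open>2\<close> off it;
    the blocks through \<open>x\<close> then determine the values at \<open>p\<close>, \<open>q\<close>, \<open>r\<close>. The default \<open>0\<close> is the value at \<open>a\<close>.\<close>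
  define f :: "'a \<Rightarrow> nat" where
    "f = (\<lambda>_. 0)(b := 1, c := 3, x := 2, p := 6, q := 4, r := 5)"
  have f: "f a = 0" "f b = 1" "f c = 3" "f x = 2" "f p = 6" "f q = 4" "f r = 5"
    using dist by (auto simp: f_def)
  have "bij_betw f {a, b, c, x, p, q, r} fano_points"
    unfolding bij_betw_def fano_points_def inj_on_def by (auto simp: f)
  moreover have "(\<lambda>b. f ` b) ` B = fano_blocks"
    unfolding B fano_blocks_def by (simp add: f insert_commute)
  ultimately show ?thesis
    unfolding is_fano_plane_def triple_system_iso_def by blast
qed

lemma intersecting_imp_fano_plane:
  assumes sts: "steiner_triple_system V B" and "card V > 3"
    and meet: "\<And>b c. b \<in> B \<Longrightarrow> c \<in> B \<Longrightarrow> b \<inter> c \<noteq> {}"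
  shows "is_fano_plane V B"
proof -
  have in_V: "e \<subseteq> V" "card e = 3" if "e \<in> B" for e
    using sts that unfolding steiner_triple_system_def by blast+
  note mem = steiner_block_mem[OF sts]
  have "finite V"
    using sts unfolding steiner_triple_system_def by blast
  obtain a b where ab: "a \<in> V" "b \<in> V" "a \<noteq> b"
    using \<open>card V > 3\<close> card_le_Suc0_iff_eq[OF \<open>finite V\<close>] by force
  obtain c where abc: "{a, b, c} \<in> B" "c \<noteq> a" "c \<noteq> b"
    using steiner_third_point[OF sts ab] .
  have "\<not> V \<subseteq> {a, b, c}"
    using \<open>card V > 3\<close> card_mono[of "{a, b, c}" V] in_V(2)[OF abc(1)] by auto
  then obtain x where x: "x \<in> V" "x \<noteq> a" "x \<noteq> b" "x \<noteq> c"
    by blast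
  have "c \<in> V"
    using in_V abc by blast
  obtain p where p: "{x, a, p} \<in> B" "p \<noteq> x" "p \<noteq> a"
    using steiner_third_point[OF sts \<open>x \<in> V\<close> \<open>a \<in> V\<close> \<open>x \<noteq> a\<close>] .
  obtain q where q: "{x, b, q} \<in> B" "q \<noteq> x" "q \<noteq> b"
    using steiner_third_point[OF sts \<open>x \<in> V\<close> \<open>b \<in> V\<close> \<open>x \<noteq> b\<close>] .
  obtain r where r: "{x, c, r} \<in> B" "r \<noteq> x" "r \<noteq> c"
    using steiner_third_point[OF sts \<open>x \<in> V\<close> \<open>c \<in> V\<close> \<open>x \<noteq> c\<close>] .
  have off: "p \<notin> {a, b, c}" "q \<notin> {a, b, c}" "r \<notin> {a, b, c}"
    using mem[OF p(1) abc(1), of a p x] mem[OF q(1) abc(1), of b q x]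
      mem[OF r(1) abc(1), of c r x] p(3) q(3) r(3) x by blast+
  have pqr: "p \<noteq> q" "p \<noteq> r" "q \<noteq> r"
    using mem[OF p(1) q(1), of x p a] mem[OF p(1) r(1), of x p a]
      mem[OF q(1) r(1), of x q b] p q r x ab abc off by blast+
  have dist: "distinct [a, b, c, x, p, q, r]"
    using ab abc x p q r off pqr by auto
  have V: "V = {a, b, c, x, p, q, r}"
  proof
    show "V \<subseteq> {a, b, c, x, p, q, r}"
    proof
      fix y assume "y \<in> V"
      show "y \<in> {a, b, c, x, p, q, r}"
      proof (cases "y = x")
        case False
        then obtain e where e: "e \<in> B" "x \<in> e" "y \<in> e"
          using steiner_block_through[OF sts \<open>x \<in> V\<close> \<open>y \<in> V\<close>] by metis
        moreover have "a \<in> e \<or> b \<in> e \<or> c \<in> e"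
          using meet[OF e(1) abc(1)] by blast
        ultimately show ?thesis
          using mem[OF e(1) p(1), of x a y] mem[OF e(1) q(1), of x b y]
            mem[OF e(1) r(1), of x c y] x by blast
      qed simp
    qed
    show "{a, b, c, x, p, q, r} \<subseteq> V"
      using in_V(1) abc p q r by blast
  qed
  \<comment> \<open>The third point on \<open>a\<close> and \<open>q\<close> is \<open>r\<close>: the blocks \<open>{a, b, c}\<close> and \<open>{x, a, p}\<close> already join
    \<open>a\<close> to the other four points. The next two blocks arise in the same way.\<close>
  have aqr: "{a, q, r} \<in> B"
  proof -
    obtain z where z: "{a, q, z} \<in> B" "z \<noteq> a" "z \<noteq> q"
      using steiner_third_point[OF sts, of a q] V dist by auto
    have "z \<in> V" using in_V z by blast
    moreover have "z \<notin> {b, c}" using mem[OF z(1) abc(1), of a z q] z dist by auto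
    moreover have "z \<notin> {x, p}" using mem[OF z(1) p(1), of a z q] z dist by auto
    ultimately show ?thesis using z V by auto
  qed
  have bpr: "{b, p, r} \<in> B"
  proof -
    obtain z where z: "{b, p, z} \<in> B" "z \<noteq> b" "z \<noteq> p"
      using steiner_third_point[OF sts, of b p] V dist by auto
    have "z \<in> V" using in_V z by blast
    moreover have "z \<notin> {a, c}" using mem[OF z(1) abc(1), of b z p] z dist by auto
    moreover have "z \<notin> {x, q}" using mem[OF z(1) q(1), of b z p] z dist by auto
    ultimately show ?thesis using z V by auto
  qed
  have cpq: "{c, p, q} \<in> B"
  proof -
    obtain z where z: "{c, p, z} \<in> B" "z \<noteq> c" "z \<noteq> p"
      using steiner_third_point[OF sts, of c p] V dist by auto
    have "z \<in> V" using in_V z by blast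
    moreover have "z \<notin> {a, b}" using mem[OF z(1) abc(1), of c z p] z dist by auto
    moreover have "z \<notin> {x, r}" using mem[OF z(1) r(1), of c z p] z dist by auto
    ultimately show ?thesis using z V by auto
  qed
  let ?F = "{{a, b, c}, {x, a, p}, {x, b, q}, {x, c, r}, {a, q, r}, {b, p, r}, {c, p, q}}"
  have "?F \<subseteq> B"
    using abc p q r aqr bpr cpq by blast
  have pair: "\<exists>e\<in>?F. y \<in> e \<and> z \<in> e" if "y \<in> V" "z \<in> V" for y z
    using that unfolding V by auto
  have "B \<subseteq> ?F"
  proof
    fix e assume "e \<in> B"
    obtain y z w where e: "e = {y, z, w}" "y \<noteq> z"
      using steiner_block_points[OF sts \<open>e \<in> B\<close>] by metis
    then have "y \<in> V" "z \<in> V"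
      using in_V(1)[OF \<open>e \<in> B\<close>] by auto
    then obtain d where d: "d \<in> ?F" "y \<in> d" "z \<in> d"
      using pair by meson
    have "d \<in> B"
      using d(1) \<open>?F \<subseteq> B\<close> by (rule rev_subsetD)
    then have "e = d"
      using steiner_block_unique[OF sts \<open>e \<in> B\<close> _ e(2)] d(2,3) e(1) by simp
    then show "e \<in> ?F"
      using d(1) by simp
  qed
  then have "B = ?F"
    using \<open>?F \<subseteq> B\<close> by (rule subset_antisym)
  then show ?thesis
    unfolding V by (rule fano_plane_coordinates[OF dist])
qed

theorem proposition1p11:
  fixes V :: "'a set" and B :: "'a set set"
  assumes "steiner_triple_system V B"
    and "card V > 3"
    and "\<not> is_fano_plane V B"
  shows "contains_wicket V B"
  using intersecting_imp_fano_plane[OF assms(1,2)] disjoint_blocks_imp_wicket[OF assms(1)] assms(3)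
  by blast

end
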